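(* The polynomial $S_{12,6}(A,B)$ is not cyclically equivalent to a sum of (Hermitian) squares in $\mathbf{R}\langle X,Y\rangle$, where $A=X^2$ and $B=Y^2$.
   Context: $\mathbf{R}\langle X,Y\rangle$ is the algebra of real polynomials in noncommuting variables $X$ and $Y$, endowed with the linear, anti-multiplicative involution $*$ such that $X^*=X$ and $Y^*=Y$. Put $A=X^2$ and $B=Y^2$. $S_{12,6}(A,B)$ denotes the sum of all words of length $12$ in the letters $A$ and $B$ having exactly $6$ letters equal to $B$ and $6$ letters equal to $A$, regarded as an element of $\mathbf{R}\langle X,Y\rangle$. A sum of squares means a finite sum of Hermitian squares, i.e. of elements of the form $f^*f$ with $f\in\mathbf{R}\langle X,Y\rangle$. Two elements $a,b\in\mathbf{R}\langle X,Y\rangle$ are cyclically equivalent if $a-b$ is a finite sum of commutators $[g,h]=gh-hg$ with $g,h\in\mathbf{R}\langle X,Y\rangle$. *)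

theory Defs
  imports Complex_Main "HOL-Library.Poly_Mapping"
begin

datatype letter = LX | LY

datatype word = Word (letters: "letter list")

text \<open>
  Words form the free monoid on two generators, written additively because the
  convolution product of \<^theory>\<open>HOL-Library.Poly_Mapping\<close> is indexed by an additive monoid.
  Hence \<open>ncpoly\<close> is the monoid algebra of the free monoid, that is, the free
  (noncommutative) unital real algebra on two generators.
\<close>

instantiation word :: monoid_add
begin

definition zero_word :: word where "0 = Word []"

definition plus_word :: "word \<Rightarrow> word \<Rightarrow> word"
  where "u + v = Word (letters u @ letters v)"

instance
  by standard (simp_all add: zero_word_def plus_word_def)

end

type_synonym ncpoly = "word \<Rightarrow>\<^sub>0 real"

definition ncX :: ncpoly where "ncX = Poly_Mapping.single (Word [LX]) 1"

definition ncY :: ncpoly where "ncY = Poly_Mapping.single (Word [LY]) 1"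

definition nc_const :: "real \<Rightarrow> ncpoly" where "nc_const c = Poly_Mapping.single 0 c"

definition rev_word :: "word \<Rightarrow> word" where "rev_word w = Word (rev (letters w))"

text \<open>
  The involution reverses words: the coefficient of \<open>w\<close> in \<open>nc_star f\<close> is the coefficient
  of the reversed word in \<open>f\<close>. The lemmas below confirm that it is linear,
  anti-multiplicative, involutive, and fixes both generators.
\<close>

definition nc_star :: "ncpoly \<Rightarrow> ncpoly"
  where "nc_star f = Poly_Mapping.map_key rev_word f"

lemma rev_word_rev_word [simp]: "rev_word (rev_word w) = w"
  by (simp add: rev_word_def)

lemma inj_rev_word: "inj rev_word"
  by (metis injI rev_word_rev_word)

lemma rev_word_plus: "rev_word (u + v) = rev_word v + rev_word u"
  by (simp add: rev_word_def plus_word_def)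

lemma lookup_nc_star: "Poly_Mapping.lookup (nc_star f) w = Poly_Mapping.lookup f (rev_word w)"
  by (simp add: nc_star_def map_key.rep_eq[OF inj_rev_word])

lemma nc_star_nc_star [simp]: "nc_star (nc_star f) = f"
  by (rule poly_mapping_eqI) (simp add: lookup_nc_star)

lemma nc_star_zero [simp]: "nc_star 0 = 0"
  by (rule poly_mapping_eqI) (simp add: lookup_nc_star)

lemma nc_star_add: "nc_star (f + g) = nc_star f + nc_star g"
  by (rule poly_mapping_eqI) (simp add: lookup_nc_star lookup_add)

lemma nc_star_single:
  "nc_star (Poly_Mapping.single w c) = Poly_Mapping.single (rev_word w) c"
  by (rule poly_mapping_eqI)
     (metis lookup_nc_star lookup_single_eq lookup_single_not_eq rev_word_rev_word)

lemma nc_star_sum: "nc_star (sum f A) = (\<Sum>a\<in>A. nc_star (f a))"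
  by (induction A rule: infinite_finite_induct) (simp_all add: nc_star_add)

lemma ncpoly_expand:
  fixes f :: ncpoly
  shows "(\<Sum>w\<in>Poly_Mapping.keys f. Poly_Mapping.single w (Poly_Mapping.lookup f w)) = f"
  by (rule poly_mapping_eqI) (simp add: lookup_sum lookup_single when_def in_keys_iff)

lemma nc_star_mult: "nc_star (f * g) = nc_star g * nc_star f"
proof -
  let ?m = "\<lambda>h w. Poly_Mapping.single w (Poly_Mapping.lookup h w) :: ncpoly"
  let ?F = "Poly_Mapping.keys f" and ?G = "Poly_Mapping.keys g"
  have "nc_star ((\<Sum>u\<in>?F. ?m f u) * (\<Sum>v\<in>?G. ?m g v)) =
        (\<Sum>u\<in>?F. \<Sum>v\<in>?G. nc_star (?m g v) * nc_star (?m f u))"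
    by (simp add: sum_product nc_star_sum nc_star_single mult_single rev_word_plus mult.commute)
  also have "\<dots> = nc_star (\<Sum>v\<in>?G. ?m g v) * nc_star (\<Sum>u\<in>?F. ?m f u)"
    unfolding nc_star_sum sum_product by (rule sum.swap)
  finally show ?thesis
    by (simp add: ncpoly_expand)
qed

lemma nc_star_const [simp]: "nc_star (nc_const c) = nc_const c"
  by (simp add: nc_const_def nc_star_single) (simp add: rev_word_def zero_word_def)

lemma nc_const_commute: "nc_const c * f = f * nc_const c"
proof -
  have "nc_const c * (\<Sum>w\<in>Poly_Mapping.keys f. Poly_Mapping.single w (Poly_Mapping.lookup f w)) =
        (\<Sum>w\<in>Poly_Mapping.keys f. Poly_Mapping.single w (Poly_Mapping.lookup f w)) * nc_const c"
    by (simp add: nc_const_def sum_distrib_left sum_distrib_right mult_single mult.commute)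
  then show ?thesis
    by (simp add: ncpoly_expand)
qed

lemma nc_star_scale: "nc_star (nc_const c * f) = nc_const c * nc_star f"
  by (simp add: nc_star_mult nc_const_commute)

lemma nc_star_X [simp]: "nc_star ncX = ncX"
  and nc_star_Y [simp]: "nc_star ncY = ncY"
  by (simp_all add: ncX_def ncY_def nc_star_single rev_word_def)

text \<open>
  \<open>S_poly m k a b\<close> sums the values of all formal words of length \<open>m\<close> in two letters, exactly
  \<open>k\<close> of which are the second letter, with \<open>a\<close> and \<open>b\<close> substituted for the first and the
  second letter. The index set consists of formal words, so that distinct words are counted
  separately.
\<close>

definition S_poly :: "nat \<Rightarrow> nat \<Rightarrow> ncpoly \<Rightarrow> ncpoly \<Rightarrow> ncpoly"
  where "S_poly m k a b =
    (\<Sum>w \<in> {w :: letter list. length w = m \<and> count_list w LY = k}.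
       prod_list (map (case_letter a b) w))"

lemma finite_S_poly_index: "finite {w :: letter list. length w = m \<and> count_list w LY = k}"
proof (rule finite_subset)
  show "finite {w. set w \<subseteq> {LX, LY} \<and> length w = m}"
    by (simp add: finite_lists_length_eq)
  show "{w. length w = m \<and> count_list w LY = k} \<subseteq> {w. set w \<subseteq> {LX, LY} \<and> length w = m}"
    using letter.exhaust by blast
qed

definition sum_of_squares :: "ncpoly \<Rightarrow> bool"
  where "sum_of_squares p \<longleftrightarrow> (\<exists>fs :: ncpoly list. p = (\<Sum>f\<leftarrow>fs. nc_star f * f))"

definition cyclically_equivalent :: "ncpoly \<Rightarrow> ncpoly \<Rightarrow> bool"
  where "cyclically_equivalent a b \<longleftrightarrow>
    (\<exists>cs :: (ncpoly \<times> ncpoly) list. a - b = (\<Sum>(g, h)\<leftarrow>cs. g * h - h * g))"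

end

theory Submission
  imports Defs
begin

text \<open>
  A sum of squares is separated from \<open>S = S_poly 12 6 (X\<^sup>2) (Y\<^sup>2)\<close> by a linear functional. A
  functional that takes the same value on \<open>v @ w\<close> and \<open>w @ v\<close> for all words kills commutators, so
  it suffices to find such a tracial functional \<open>L\<close> with \<open>L (f\<^sup>* f) \<ge> 0\<close> for every \<open>f\<close> that can
  occur, and with \<open>L S < 0\<close>. No \<open>L\<close> that comes from a trace of matrices will do: by the theorem
  of Stahl (the BMV conjecture) all of these are nonnegative on \<open>S\<close>. The functional is therefore
  given by an explicit table of values on cyclic words.

  Which \<open>f\<close> can occur is limited by a degree argument (\<open>support_degree_bound\<close>): since \<open>S\<close> has
  degree 12 in \<open>X\<close> and in \<open>Y\<close>, the polynomials in the squares have degree at most 6 in each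
  letter. Otherwise the parts of the highest degree would have squares adding up to something
  cyclically equivalent to 0, and evaluation at suitable symmetric matrices, the labelled
  adjacency matrices of a path, excludes this.

  A word of bidegree (12,12) then arises in \<open>f\<^sup>* f\<close> only as \<open>rev u @ v\<close> with \<open>u\<close> and \<open>v\<close> of
  bidegree (6,6). Let \<open>L\<close> be zero on all words that are not cyclically a word in \<open>X\<^sup>2\<close> and \<open>Y\<^sup>2\<close>.
  Then \<open>rev u @ v\<close> can contribute only in two ways: either \<open>u\<close> and \<open>v\<close> are themselves words in the
  squares, or \<open>u = l a l\<close> and \<open>v = l b l\<close> with a common letter \<open>l\<close> and words \<open>a\<close>, \<open>b\<close> in the
  squares. So nonnegativity of \<open>L\<close> on squares amounts to positive semidefiniteness of one
  \<open>20 \<times> 20\<close> and two \<open>10 \<times> 10\<close> matrices, and interchanging the letters identifies the last two.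
  Modulo rotation, reversal and interchange of the letters, there are 35 words with six letters
  of each kind. The 35 integers in \<open>class_table\<close> make both matrices positive definite
  (\<open>even_form_nonneg\<close>, \<open>odd_form_nonneg_X\<close>), while their sum over the 924 words of \<open>S\<close> is
  negative (\<open>sum_class_value\<close>).
\<close>

section \<open>Linear functionals given by weights on words\<close>

text \<open>
  Coefficients, supports and weights are indexed by bare letter lists, on which the library
  functions for lists are available.
\<close>

definition coeff :: "ncpoly \<Rightarrow> letter list \<Rightarrow> real"
  where "coeff p xs = Poly_Mapping.lookup p (Word xs)"

definition support :: "ncpoly \<Rightarrow> letter list set"
  where "support p = letters ` Poly_Mapping.keys p"

definition functional :: "(letter list \<Rightarrow> real) \<Rightarrow> ncpoly \<Rightarrow> real"
  where "functional m p = (\<Sum>xs\<in>support p. coeff p xs * m xs)"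

definition tracial :: "(letter list \<Rightarrow> real) \<Rightarrow> bool"
  where "tracial m \<longleftrightarrow> (\<forall>xs ys. m (xs @ ys) = m (ys @ xs))"

lemma finite_support [simp]: "finite (support p)"
  by (simp add: support_def)

lemma in_support_iff: "xs \<in> support p \<longleftrightarrow> coeff p xs \<noteq> 0"
  by (force simp: support_def coeff_def in_keys_iff image_iff intro: bexI[of _ "Word xs"])

lemma functional_superset:
  assumes "finite A" "\<And>xs. xs \<in> support p \<Longrightarrow> m xs \<noteq> 0 \<Longrightarrow> xs \<in> A"
  shows "functional m p = (\<Sum>xs\<in>A. coeff p xs * m xs)"
proof -
  have "functional m p = (\<Sum>xs\<in>support p \<inter> A. coeff p xs * m xs)"
    unfolding functional_def using assms by (intro sum.mono_neutral_right) auto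
  also have "\<dots> = (\<Sum>xs\<in>A. coeff p xs * m xs)"
    using assms by (intro sum.mono_neutral_left) (auto simp: in_support_iff)
  finally show ?thesis .
qed

lemma functional_add: "functional m (p + q) = functional m p + functional m q"
proof -
  let ?A = "support p \<union> support q \<union> support (p + q)"
  have *: "functional m r = (\<Sum>xs\<in>?A. coeff r xs * m xs)"
    if "r \<in> {p, q, p + q}" for r
    using that by (intro functional_superset) auto
  show ?thesis
    by (simp add: * coeff_def lookup_add distrib_right sum.distrib)
qed

lemma functional_zero [simp]: "functional m 0 = 0"
  by (simp add: functional_def support_def)

lemma functional_uminus: "functional m (- p) = - functional m p"
  using functional_add[of m p "- p"] by simp

lemma functional_diff: "functional m (p - q) = functional m p - functional m q"
  using functional_add[of m p "- q"] by (simp add: functional_uminus)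

lemma functional_sum: "functional m (\<Sum>i\<in>I. p i) = (\<Sum>i\<in>I. functional m (p i))"
  by (induction I rule: infinite_finite_induct) (simp_all add: functional_add)

lemma functional_sum_list:
  "functional m (\<Sum>i\<leftarrow>is. p i) = (\<Sum>i\<leftarrow>is. functional m (p i))"
  by (induction "is") (simp_all add: functional_add)

lemma functional_single [simp]: "functional m (Poly_Mapping.single (Word xs) c) = c * m xs"
  by (subst functional_superset[of "{xs}"])
    (auto simp: in_support_iff coeff_def lookup_single when_def split: if_splits)

lemma expand_by_support:
  "p = (\<Sum>xs\<in>support p. Poly_Mapping.single (Word xs) (coeff p xs))"
proof -
  have "inj_on letters (Poly_Mapping.keys p)"
    by (auto intro!: inj_onI word.expand)
  then have "(\<Sum>xs\<in>support p. Poly_Mapping.single (Word xs) (coeff p xs)) =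
      (\<Sum>w\<in>Poly_Mapping.keys p. Poly_Mapping.single w (Poly_Mapping.lookup p w))"
    by (simp add: support_def sum.reindex coeff_def)
  then show ?thesis
    by (simp add: ncpoly_expand)
qed

lemma functional_mult:
  "functional m (p * q) =
     (\<Sum>xs\<in>support p. \<Sum>ys\<in>support q. coeff p xs * coeff q ys * m (xs @ ys))"
proof -
  let ?m = "\<lambda>r xs. Poly_Mapping.single (Word xs) (coeff r xs)"
  have "p * q = (\<Sum>xs\<in>support p. ?m p xs) * (\<Sum>ys\<in>support q. ?m q ys)"
    using expand_by_support by simp
  also have "\<dots> = (\<Sum>xs\<in>support p. \<Sum>ys\<in>support q.
      Poly_Mapping.single (Word (xs @ ys)) (coeff p xs * coeff q ys))"
    by (simp add: sum_product mult_single plus_word_def)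
  finally show ?thesis
    by (simp add: functional_sum)
qed

text \<open>
  The value on a Hermitian square is a quadratic form in the coefficients, whose matrix has
  the entry \<open>m (rev xs @ ys)\<close> at the words \<open>xs\<close> and \<open>ys\<close>.
\<close>

lemma functional_square:
  "functional m (nc_star f * f) =
     (\<Sum>xs\<in>support f. \<Sum>ys\<in>support f. coeff f xs * coeff f ys * m (rev xs @ ys))"
proof -
  have c: "coeff (nc_star f) xs = coeff f (rev xs)" for xs
    by (simp add: coeff_def lookup_nc_star rev_word_def)
  have "xs \<in> support (nc_star f) \<longleftrightarrow> xs \<in> rev ` support f" for xs
  proof -
    have "xs \<in> rev ` support f \<longleftrightarrow> rev xs \<in> support f"
      by (metis image_iff rev_rev_ident)
    then show ?thesis
      by (simp add: in_support_iff c)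
  qed
  then have "support (nc_star f) = rev ` support f"
    by blast
  then show ?thesis
    by (simp add: functional_mult c sum.reindex)
qed

lemma functional_commutator:
  assumes "tracial m"
  shows "functional m (g * h - h * g) = 0"
proof -
  have "functional m (h * g) = functional m (g * h)"
    unfolding functional_mult using assms
    by (subst sum.swap) (simp add: tracial_def mult.commute)
  then show ?thesis
    by (simp add: functional_diff)
qed

lemma functional_cyclically_equivalent:
  assumes "tracial m" and "cyclically_equivalent p q"
  shows "functional m p = functional m q"
proof -
  from assms(2) obtain cs where cs: "p - q = (\<Sum>(g, h)\<leftarrow>cs. g * h - h * g)"
    unfolding cyclically_equivalent_def by blast
  have "functional m (p - q) = 0"
    unfolding cs functional_sum_list using functional_commutator[OF assms(1)]
    by (induction cs) auto
  then show ?thesis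
    by (simp add: functional_diff)
qed

section \<open>The degree bound for sums of squares\<close>

text \<open>
  A word \<open>u\<close> of length \<open>d\<close> labels the edges of a path with the vertices \<open>0, \<dots>, d\<close>: the edge
  between \<open>i\<close> and \<open>i + 1\<close> carries the letter \<open>u ! i\<close>. Substituting for each letter the adjacency
  matrix of the edges labelled by it is an evaluation of noncommutative polynomials at symmetric
  matrices. The number of walks labelled by \<open>w\<close> from \<open>i\<close> to \<open>j\<close> is the entry \<open>(i, j)\<close> of the
  value of \<open>w\<close>, and the number of closed walks is its trace.
\<close>

definition adjacent :: "letter list \<Rightarrow> letter \<Rightarrow> nat \<Rightarrow> nat \<Rightarrow> bool"
  where "adjacent u l i j \<longleftrightarrow>
    j = Suc i \<and> i < length u \<and> u ! i = l \<or> i = Suc j \<and> j < length u \<and> u ! j = l"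

primrec walks :: "letter list \<Rightarrow> letter list \<Rightarrow> nat \<Rightarrow> nat \<Rightarrow> real" where
  "walks u [] i j = of_bool (i = j)"
| "walks u (l # w) i j = (\<Sum>k\<le>length u. of_bool (adjacent u l i k) * walks u w k j)"

definition closed_walks :: "letter list \<Rightarrow> letter list \<Rightarrow> real"
  where "closed_walks u w = (\<Sum>i\<le>length u. walks u w i i)"

lemma walks_append:
  assumes "i \<le> length u"
  shows "walks u (v @ w) i j = (\<Sum>k\<le>length u. walks u v i k * walks u w k j)"
  using assms
proof (induction v arbitrary: i)
  case Nil
  then show ?case
    by (simp add: of_bool_def if_distrib[of "\<lambda>x. x * _"] sum.delta cong: if_cong)
next
  case (Cons l v)
  then show ?case
    by (simp add: sum_distrib_left sum_distrib_right mult.assoc del: sum_of_bool_mult_eq)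
      (rule sum.swap)
qed

lemma walks_rev:
  assumes "i \<le> length u" "j \<le> length u"
  shows "walks u (rev w) i j = walks u w j i"
  using assms
proof (induction w arbitrary: i j)
  case Nil
  then show ?case
    by (auto simp: of_bool_def)
next
  case (Cons l w)
  have "adjacent u l k j = adjacent u l j k" for k
    by (auto simp: adjacent_def)
  moreover have "walks u [l] k j = of_bool (adjacent u l k j)" if "k \<le> length u" for k
    using Cons.prems
    by (simp add: of_bool_def if_distrib[of "\<lambda>x. _ * x"] sum.delta cong: if_cong)
  ultimately show ?case
    using Cons by (simp add: walks_append mult.commute del: walks.simps(2)) simp
qed

lemma tracial_closed_walks: "tracial (closed_walks u)"
  unfolding tracial_def closed_walks_def
  by (intro allI) (simp add: walks_append, subst sum.swap, simp add: mult.commute)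

text \<open>
  A walk that reaches the end of the path in no more steps than the distance moves to the right
  in every step, and so it reads off the labels.
\<close>

lemma walks_to_end:
  assumes "i + length w \<le> length u"
  shows "walks u w i (length u) = of_bool (w = drop i u)"
  using assms
proof (induction w arbitrary: i)
  case Nil
  then show ?case
    by auto
next
  case (Cons l w)
  have "of_bool (adjacent u l i k) * walks u w k (length u) =
      (if k = Suc i then of_bool (l # w = drop i u) else 0)" if "k \<le> length u" for k
  proof (cases "adjacent u l i k")
    case True
    then consider "k = Suc i" "u ! i = l" | "i = Suc k"
      by (auto simp: adjacent_def)
    then show ?thesis
    proof cases
      case 1
      then show ?thesis
        using True Cons.IH[of k] Cons.prems by (auto simp: Cons_nth_drop_Suc[symmetric])
    next
      case 2
      have "length w \<noteq> length (drop k u)"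
        using 2 Cons.prems by auto
      then have "w \<noteq> drop k u"
        by blast
      then show ?thesis
        using 2 True Cons.IH[of k] Cons.prems by simp
    qed
  next
    case False
    have "l # w \<noteq> drop i u" if "k = Suc i"
      using that False Cons.prems by (auto simp: adjacent_def Cons_nth_drop_Suc[symmetric])
    then show ?thesis
      using False by auto
  qed
  then have "walks u (l # w) i (length u) =
      (\<Sum>k\<le>length u. if k = Suc i then of_bool (l # w = drop i u) else 0)"
    unfolding walks.simps by (intro sum.cong) auto
  then show ?case
    using Cons.prems by (simp add: sum.delta)
qed

text \<open>
  For a matrix \<open>N\<close>, the trace of \<open>N\<^sup>T N\<close> is the sum of the squares of all entries of \<open>N\<close>.
\<close>

lemma closed_walks_square:
  fixes c :: "letter list \<Rightarrow> real"
  shows "(\<Sum>v\<in>K. \<Sum>w\<in>K. c v * c w * closed_walks u (rev v @ w)) =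
    (\<Sum>j\<le>length u. \<Sum>i\<le>length u. (\<Sum>w\<in>K. c w * walks u w i j)\<^sup>2)"
proof -
  have "(\<Sum>v\<in>K. \<Sum>w\<in>K. c v * c w * closed_walks u (rev v @ w)) =
      (\<Sum>v\<in>K. \<Sum>w\<in>K. \<Sum>j\<le>length u. \<Sum>i\<le>length u.
         (c v * walks u v i j) * (c w * walks u w i j))"
    unfolding closed_walks_def sum_distrib_left
    by (intro sum.cong refl) (simp add: walks_append walks_rev sum_distrib_left mult.assoc mult.left_commute)
  also have "\<dots> = (\<Sum>j\<le>length u. \<Sum>i\<le>length u. \<Sum>v\<in>K. \<Sum>w\<in>K.
         (c v * walks u v i j) * (c w * walks u w i j))"
    by (simp only: sum.swap[where A = K and B = "{..length u}"])
  finally show ?thesis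
    by (simp add: power2_eq_square sum_product)
qed

text \<open>
  If \<open>M > n\<close> is the greatest \<open>z\<close>-degree in the supports, the part of \<open>z\<close>-degree \<open>2 * M\<close> of the
  sum of squares is the sum of the squares of the parts of \<open>z\<close>-degree \<open>M\<close>. A tracial functional
  restricted to the words of \<open>z\<close>-degree \<open>2 * M\<close> is still tracial and vanishes on \<open>p\<close>. The trace
  of the evaluation along the path labelled by \<open>u\<close> is nonnegative on each of these squares, and
  it is positive on one of them if \<open>u\<close> is chosen among the words of \<open>z\<close>-degree \<open>M\<close> as a longest
  one, because the corner entry of the matrix then isolates the coefficient of \<open>u\<close>.
\<close>

lemma support_degree_bound:
  assumes "cyclically_equivalent p (\<Sum>f\<leftarrow>fs. nc_star f * f)"
    and deg: "\<And>w. w \<in> support p \<Longrightarrow> count_list w z \<le> 2 * n"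
    and "f \<in> set fs" "w \<in> support f"
  shows "count_list w z \<le> n"
proof (rule ccontr)
  define D where "D = (\<Union>f\<in>set fs. support f)"
  assume "\<not> count_list w z \<le> n"
  define M where "M = Max ((\<lambda>w. count_list w z) ` D)"
  have fin: "finite D" and wD: "w \<in> D"
    using assms by (auto simp: D_def)
  have le: "count_list v z \<le> M" if "v \<in> D" for v
    unfolding M_def using fin that by (intro Max_ge) auto
  have "M > n"
    using le[OF wD] \<open>\<not> count_list w z \<le> n\<close> by simp
  define T where "T = {v \<in> D. count_list v z = M}"
  have "M \<in> (\<lambda>w. count_list w z) ` D"
    unfolding M_def using fin wD by (intro Max_in) auto
  then have "T \<noteq> {}" "finite T"
    using fin by (auto simp: T_def)
  \<comment> \<open>The degree in the other letter is not controlled here, so \<open>u\<close> has to be of maximal length: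
    longer words could also lead from one end of the path to the other.\<close>
  then obtain u where u: "u \<in> T" and u_max: "\<And>v. v \<in> T \<Longrightarrow> length v \<le> length u"
    using Max_in[of "length ` T"] Max_ge[of "length ` T"] by fastforce
  define m where "m = (\<lambda>w. if count_list w z = 2 * M then closed_walks u w else 0)"
  have "tracial m"
    using tracial_closed_walks[of u] by (simp add: tracial_def m_def add.commute)
  have "functional m p = 0"
    unfolding functional_def m_def using deg \<open>M > n\<close> by (intro sum.neutral) force
  \<comment> \<open>Since \<open>M\<close> is maximal, only words of \<open>z\<close>-degree \<open>M\<close> contribute to a square.\<close>
  have square: "functional m (nc_star f * f) =
      (\<Sum>j\<le>length u. \<Sum>i\<le>length u. (\<Sum>w\<in>support f \<inter> T. coeff f w * walks u w i j)\<^sup>2)"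
    if "f \<in> set fs" for f
  proof -
    have *: "m (rev v @ w) =
        (if v \<in> support f \<inter> T \<and> w \<in> support f \<inter> T then closed_walks u (rev v @ w) else 0)"
      if "v \<in> support f" "w \<in> support f" for v w
    proof -
      have "v \<in> D" "w \<in> D"
        using that \<open>f \<in> set fs\<close> by (auto simp: D_def)
      with le[of v] le[of w] show ?thesis
        using that by (auto simp: m_def T_def)
    qed
    have "functional m (nc_star f * f) =
        (\<Sum>v\<in>support f \<inter> T. \<Sum>w\<in>support f.  coeff f v * coeff f w * m (rev v @ w))"
      unfolding functional_square by (intro sum.mono_neutral_right) (auto simp: *)
    also have "\<dots> = (\<Sum>v\<in>support f \<inter> T. \<Sum>w\<in>support f \<inter> T.
        coeff f v * coeff f w * m (rev v @ w))"
      by (intro sum.cong refl sum.mono_neutral_right) (auto simp: *)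
    also have "\<dots> = (\<Sum>v\<in>support f \<inter> T. \<Sum>w\<in>support f \<inter> T.
        coeff f v * coeff f w * closed_walks u (rev v @ w))"
      by (intro sum.cong refl) (auto simp: *)
    finally show ?thesis
      by (simp add: closed_walks_square)
  qed
  have nonneg: "functional m (nc_star f * f) \<ge> 0" if "f \<in> set fs" for f
    by (simp add: square[OF that] sum_nonneg)
  from u obtain g where g: "g \<in> set fs" "u \<in> support g"
    by (auto simp: T_def D_def)
  have "(\<Sum>w\<in>support g \<inter> T. coeff g w * walks u w 0 (length u)) =
      (\<Sum>w\<in>support g \<inter> T. if w = u then coeff g u else 0)"
    using u_max by (intro sum.cong) (auto simp: walks_to_end)
  also have "\<dots> = coeff g u"
    using g u by (simp add: sum.delta)
  finally have end_entry: "(\<Sum>w\<in>support g \<inter> T. coeff g w * walks u w 0 (length u)) = coeff g u" .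
  have "0 < (coeff g u)\<^sup>2"
    using g by (simp add: in_support_iff)
  also have "\<dots> \<le> (\<Sum>i\<le>length u. (\<Sum>w\<in>support g \<inter> T. coeff g w * walks u w i (length u))\<^sup>2)"
    unfolding end_entry[symmetric] by (rule member_le_sum) auto
  also have "\<dots> \<le> functional m (nc_star g * g)"
    unfolding square[OF g(1)]
    by (rule member_le_sum[where i = "length u" and A = "{..length u}"]) (auto intro: sum_nonneg)
  also have "\<dots> \<le> (\<Sum>f\<leftarrow>fs. functional m (nc_star f * f))"
    using g(1) nonneg by (intro member_le_sum_list) auto
  also have "\<dots> = functional m p"
    using functional_cyclically_equivalent[OF \<open>tracial m\<close> assms(1)] by (simp add: functional_sum_list)
  finally show False
    using \<open>functional m p = 0\<close> by simp
qed

section \<open>Words of a given bidegree\<close>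

definition bidegree_words :: "nat \<Rightarrow> nat \<Rightarrow> letter list set"
  where "bidegree_words i j = {w. count_list w LX = i \<and> count_list w LY = j}"

text \<open>
  Besides the set of words of a bidegree, an enumeration of it is needed to index the matrices
  below and to evaluate sums.
\<close>

fun words :: "nat \<Rightarrow> nat \<Rightarrow> letter list list" where
  "words 0 0 = [[]]"
| "words (Suc i) 0 = map (Cons LX) (words i 0)"
| "words 0 (Suc j) = map (Cons LY) (words 0 j)"
| "words (Suc i) (Suc j) = map (Cons LX) (words i (Suc j)) @ map (Cons LY) (words (Suc i) j)"

lemma Cons_in_bidegree_words:
  "LX # w \<in> bidegree_words i j \<longleftrightarrow> (\<exists>i'. i = Suc i' \<and> w \<in> bidegree_words i' j)"
  "LY # w \<in> bidegree_words i j \<longleftrightarrow> (\<exists>j'. j = Suc j' \<and> w \<in> bidegree_words i j')"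
  by (auto simp: bidegree_words_def)

lemma in_bidegree_words_cases:
  "w \<in> bidegree_words i j \<longleftrightarrow> w = [] \<and> i = 0 \<and> j = 0 \<or>
     (\<exists>v i'. w = LX # v \<and> i = Suc i' \<and> v \<in> bidegree_words i' j) \<or>
     (\<exists>v j'. w = LY # v \<and> j = Suc j' \<and> v \<in> bidegree_words i j')"
proof (cases w)
  case Nil
  then show ?thesis
    by (auto simp: bidegree_words_def)
next
  case (Cons l v)
  then show ?thesis
    by (cases l) (auto simp: Cons_in_bidegree_words)
qed

lemma set_words: "set (words i j) = bidegree_words i j"
  by (induction i j rule: words.induct; rule set_eqI; subst in_bidegree_words_cases; auto)

lemma distinct_words: "distinct (words i j)"
  by (induction i j rule: words.induct) (auto simp: distinct_map)

lemma finite_bidegree_words [simp]: "finite (bidegree_words i j)"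
  by (metis List.finite_set set_words)

lemma length_letters: "length w = count_list w LX + count_list w LY"
proof (induction w)
  case (Cons l w)
  then show ?case
    by (cases l) auto
qed simp

lemma length_bidegree_words: "w \<in> bidegree_words i j \<Longrightarrow> length w = i + j"
  by (simp add: bidegree_words_def length_letters)

section \<open>A class function on words of length twelve\<close>

text \<open>
  Reading \<open>LX\<close> as 0 and \<open>LY\<close> as 1, the least number represented by a rotation of a word
  identifies its cyclic class among the words of its length. For speed in evaluation, the minimum over all rotations is
  computed by recursion on lists.
\<close>

fun append_bit :: "int \<Rightarrow> letter \<Rightarrow> int" where
  "append_bit n LX = n + n"
| "append_bit n LY = n + n + 1"

definition binary_code :: "letter list \<Rightarrow> int"
  where "binary_code w = foldl append_bit 0 w"

primrec rotations :: "nat \<Rightarrow> letter list \<Rightarrow> letter list list" where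
  "rotations 0 w = []"
| "rotations (Suc n) w = w # rotations n (rotate1 w)"

primrec least :: "int \<Rightarrow> int list \<Rightarrow> int" where
  "least a [] = a"
| "least a (x # xs) = (if x < a then least x xs else least a xs)"

lemma least_eq_Min: "least a xs = Min (insert a (set xs))"
proof (induction xs arbitrary: a)
  case (Cons x xs)
  have "Min (insert a (insert x (set xs))) = Min (insert (if x < a then x else a) (set xs))"
    by (cases "set xs = {}") (auto simp: min_def)
  then show ?case
    using Cons by simp
qed simp

definition necklace_code :: "letter list \<Rightarrow> int"
  where "necklace_code w = least (binary_code w) (map binary_code (rotations (length w) w))"

fun swap_letter :: "letter \<Rightarrow> letter" where
  "swap_letter LX = LY"
| "swap_letter LY = LX"

definition bracelet_code :: "letter list \<Rightarrow> int"
  where "bracelet_code w = min (necklace_code w) (necklace_code (rev w))"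

definition class_code :: "letter list \<Rightarrow> int"
  where "class_code w = min (bracelet_code w) (bracelet_code (map swap_letter w))"

text \<open>
  The keys are the \<open>class_code\<close>s of the 35 classes of words with six letters of each kind, for
  example 63 for \<open>LX\<^sup>6 LY\<^sup>6\<close> and 1365 for the alternating words. The values come from a rounded
  and rescaled approximate solution of the semidefinite program that asks for a class function
  with negative total over all words and with the least eigenvalue of both Gram matrices below
  as large as possible.
\<close>

definition class_table :: "(int \<times> int) list" where
  "class_table = [
   (63, 437), (95, -81), (111, -56), (119, 66), (175, 33), (183, -26), (187, -12),
   (189, 140), (207, -364), (215, -18), (219, 92), (231, 47), (311, -15), (315, 26),
   (343, 21), (347, -10), (349, -14), (359, -16), (363, -7), (365, 36), (371, 24),
   (411, -13), (423, -14), (427, 19), (455, 43), (603, -7), (619, 16), (683, -6),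
   (685, -7), (691, -5), (693, 15), (715, -5), (717, 19), (819, 518), (1365, 11)]"

definition class_value :: "letter list \<Rightarrow> int" where
  "class_value w = (case map_of class_table (class_code w) of None \<Rightarrow> 0 | Some v \<Rightarrow> v)"

lemma set_rotations: "set (rotations n w) = (\<lambda>k. rotate k w) ` {..<n}"
proof (induction n arbitrary: w)
  case (Suc n)
  have "{..<Suc n} = insert 0 (Suc ` {..<n})"
    by (auto simp: image_iff less_Suc_eq_0_disj)
  then show ?case
    using Suc by (simp add: image_image rotate1_rotate_swap)
qed simp

lemma set_rotations_rotate1:
  "set (rotations (length w) (rotate1 w)) = set (rotations (length w) w)"
proof -
  have all: "set (rotations (length v) v) = range (\<lambda>k. rotate k v)" if "v \<noteq> []" for v :: "letter list"
    unfolding set_rotations using that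
    by (auto simp: image_iff intro!: bexI[of _ "_ mod length v"] rotate_conv_mod)
  have "range (\<lambda>k. rotate k (rotate1 w)) = range (\<lambda>k. rotate k w)"
  proof (intro equalityI subsetI)
    fix v
    assume "v \<in> range (\<lambda>k. rotate k w)"
    then obtain k where k: "v = rotate k w"
      by blast
    show "v \<in> range (\<lambda>k. rotate k (rotate1 w))"
    proof (cases "w = []")
      case True
      then show ?thesis
        using k by simp
    next
      case False
      then obtain j where j: "k + length w * Suc k = Suc j"
        by (cases "k + length w * Suc k") auto
      have "v = rotate (Suc j) w"
        unfolding k j[symmetric] by (metis mod_mult_self2 rotate_conv_mod)
      then have "v = rotate j (rotate1 w)"
        by (simp add: rotate1_rotate_swap)
      then show ?thesis
        by blast
    qed
  next
    fix v
    assume "v \<in> range (\<lambda>k. rotate k (rotate1 w))"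
    then obtain k where "v = rotate (Suc k) w"
      by (auto simp: rotate1_rotate_swap)
    then show "v \<in> range (\<lambda>k. rotate k w)"
      by blast
  qed
  then show ?thesis
    using all[of w] all[of "rotate1 w"] by (cases "w = []") simp_all
qed

lemma necklace_code_rotate1 [simp]: "necklace_code (rotate1 w) = necklace_code w"
proof (cases "w = []")
  case False
  then have "rotate 0 w \<in> set (rotations (length w) w)"
    unfolding set_rotations by blast
  moreover from False have "rotate 0 (rotate1 w) \<in> set (rotations (length w) (rotate1 w))"
    unfolding set_rotations by blast
  ultimately show ?thesis
    by (simp add: necklace_code_def least_eq_Min set_rotations_rotate1 insert_absorb)
qed simp

lemma necklace_code_rev_rotate1 [simp]: "necklace_code (rev (rotate1 w)) = necklace_code (rev w)"
proof -
  have "rotate1 (rev (rotate1 w)) = rev w"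
    by (cases w) auto
  then show ?thesis
    by (metis necklace_code_rotate1)
qed

lemma class_value_rotate1 [simp]: "class_value (rotate1 w) = class_value w"
  by (simp add: class_value_def class_code_def bracelet_code_def rotate1_map[symmetric])

lemma class_value_rev [simp]: "class_value (rev w) = class_value w"
  by (simp add: class_value_def class_code_def bracelet_code_def rev_map ac_simps)

lemma swap_letter_swap_letter [simp]: "swap_letter (swap_letter l) = l"
  by (cases l) auto

lemma class_value_swap [simp]: "class_value (map swap_letter w) = class_value w"
  by (simp add: class_value_def class_code_def bracelet_code_def o_def ac_simps)

text \<open>
  Summation by descent along the words, with the letters read so far kept in \<open>v\<close>, so that the
  evaluation never carries the list of all 924 words.
\<close>

fun sum_words :: "(letter list \<Rightarrow> int) \<Rightarrow> nat \<Rightarrow> nat \<Rightarrow> letter list \<Rightarrow> int" where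
  "sum_words f 0 0 v = f v"
| "sum_words f (Suc i) 0 v = sum_words f i 0 (LX # v)"
| "sum_words f 0 (Suc j) v = sum_words f 0 j (LY # v)"
| "sum_words f (Suc i) (Suc j) v =
     sum_words f i (Suc j) (LX # v) + sum_words f (Suc i) j (LY # v)"

lemma sum_words_eq: "sum_words f i j v = (\<Sum>w\<leftarrow>words i j. f (rev w @ v))"
  by (induction f i j v rule: sum_words.induct) (simp_all add: o_def)

text \<open>
  The table is scaled so that the mean value over the 924 words is \<open>- 1\<close>.
\<close>

lemma sum_words_class_value: "sum_words class_value 6 6 [] = - 924"
  by code_simp

lemma sum_class_value: "(\<Sum>w\<in>bidegree_words 6 6. class_value w) = - 924"
proof -
  have "(\<Sum>w\<in>bidegree_words 6 6. class_value w) = (\<Sum>w\<leftarrow>words 6 6. class_value w)"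
    by (simp add: sum_list_distinct_conv_sum_set distinct_words set_words)
  also have "\<dots> = sum_words class_value 6 6 []"
    by (simp add: sum_words_eq)
  finally show ?thesis
    by (simp add: sum_words_class_value)
qed

section \<open>Positive semidefinite matrices from rounded Cholesky factors\<close>

definition dot :: "int list \<Rightarrow> int list \<Rightarrow> int"
  where "dot x y = sum_list (map2 (*) x y)"

text \<open>
  The certificate consists of integer vectors \<open>x\<^sub>a\<close>, one for each index \<open>a\<close>, whose Gram matrix is
  close to \<open>c * M\<close>: the residual \<open>c * M a b - dot x\<^sub>a x\<^sub>b\<close> is required to be diagonally dominant.
  Such vectors are found for any positive definite \<open>M\<close> by rounding a Cholesky factor of
  \<open>c * (M - \<theta>)\<close>, with \<open>\<theta>\<close> a scalar below the least eigenvalue and \<open>c\<close> large enough to absorb the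
  rounding errors; they stay small, whereas an exact factorization would involve large
  fractions. The sum over a row includes the diagonal, which explains the factor 2 in the test.
\<close>

fun row_residual ::
    "int \<Rightarrow> ('a \<Rightarrow> 'a \<Rightarrow> int) \<Rightarrow> 'a \<Rightarrow> int list \<Rightarrow> ('a \<times> int list) list \<Rightarrow> int" where
  "row_residual c M a x [] = 0"
| "row_residual c M a x ((b, y) # rows) = \<bar>c * M a b - dot x y\<bar> + row_residual c M a x rows"

fun rows_dominant ::
    "int \<Rightarrow> ('a \<Rightarrow> 'a \<Rightarrow> int) \<Rightarrow> ('a \<times> int list) list \<Rightarrow> ('a \<times> int list) list \<Rightarrow> bool" where
  "rows_dominant c M rows [] \<longleftrightarrow> True"
| "rows_dominant c M rows ((a, x) # rest) \<longleftrightarrow>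
     row_residual c M a x rows \<le> 2 * (c * M a a - dot x x) \<and> rows_dominant c M rows rest"

definition gram_certificate ::
    "int \<Rightarrow> ('a \<Rightarrow> 'a \<Rightarrow> int) \<Rightarrow> ('a \<times> int list) list \<Rightarrow> bool"
  where "gram_certificate c M rows \<longleftrightarrow> rows_dominant c M rows rows"

lemma row_residual_eq:
  "row_residual c M a x rows = (\<Sum>(b, y)\<leftarrow>rows. \<bar>c * M a b - dot x y\<bar>)"
  by (induction rows) auto

lemma rows_dominant_iff:
  "rows_dominant c M rows rest \<longleftrightarrow> (\<forall>(a, x)\<in>set rest.
     (\<Sum>(b, y)\<leftarrow>rows. \<bar>c * M a b - dot x y\<bar>) \<le> 2 * (c * M a a - dot x x))"
  by (induction rest) (auto simp: row_residual_eq)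

text \<open>
  By the inequality \<open>2 \<bar>F a * F b\<bar> \<le> (F a)\<^sup>2 + (F b)\<^sup>2\<close>, the off-diagonal terms of a symmetric form
  are bounded by the diagonal ones weighted with the absolute row sums.
\<close>

lemma diagonally_dominant_nonneg:
  fixes E :: "'a \<Rightarrow> 'a \<Rightarrow> real"
  assumes "finite A"
    and sym: "\<And>a b. a \<in> A \<Longrightarrow> b \<in> A \<Longrightarrow> E a b = E b a"
    and dom: "\<And>a. a \<in> A \<Longrightarrow> (\<Sum>b\<in>A. \<bar>E a b\<bar>) \<le> 2 * E a a"
  shows "(\<Sum>a\<in>A. \<Sum>b\<in>A. F a * F b * E a b) \<ge> 0"
proof -
  let ?S = "\<Sum>a\<in>A. \<Sum>b\<in>A. \<bar>E a b\<bar> * (F a)\<^sup>2"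
  have *: "2 * (F a * F b * E a b) \<ge> - (\<bar>E a b\<bar> * (F a)\<^sup>2) - \<bar>E a b\<bar> * (F b)\<^sup>2" for a b
  proof -
    have "0 \<le> \<bar>E a b\<bar> * (F a + sgn (E a b) * F b)\<^sup>2"
      by simp
    also have "\<dots> = \<bar>E a b\<bar> * (F a)\<^sup>2 + 2 * (F a * F b * (\<bar>E a b\<bar> * sgn (E a b)))
        + \<bar>E a b\<bar> * (sgn (E a b))\<^sup>2 * (F b)\<^sup>2"
      by (simp add: power2_eq_square algebra_simps)
    also have "\<bar>E a b\<bar> * sgn (E a b) = E a b"
      by (auto simp: sgn_if)
    also have "\<bar>E a b\<bar> * (sgn (E a b))\<^sup>2 = \<bar>E a b\<bar>"
      by (auto simp: sgn_if)
    finally show ?thesis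
      by linarith
  qed
  have diag: "2 * (F a * F a * E a a) + (\<bar>E a a\<bar> * (F a)\<^sup>2 + \<bar>E a a\<bar> * (F a)\<^sup>2) = 4 * E a a * (F a)\<^sup>2"
    if "a \<in> A" for a
  proof -
    have "0 \<le> (\<Sum>b\<in>A. \<bar>E a b\<bar>)"
      by (simp add: sum_nonneg)
    then have "0 \<le> E a a"
      using dom[OF that] by linarith
    then show ?thesis
      by (simp add: power2_eq_square)
  qed
  have "0 \<le> 2 * (F a * F b * E a b) + (\<bar>E a b\<bar> * (F a)\<^sup>2 + \<bar>E a b\<bar> * (F b)\<^sup>2)" for a b
    using *[of a b] by linarith
  then have row: "(\<Sum>b\<in>A. 2 * (F a * F b * E a b) + (\<bar>E a b\<bar> * (F a)\<^sup>2 + \<bar>E a b\<bar> * (F b)\<^sup>2)) \<ge> 4 * E a a * (F a)\<^sup>2"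
    if "a \<in> A" for a
    unfolding diag[OF that, symmetric] using that assms(1) by (intro member_le_sum)
  have swap: "(\<Sum>a\<in>A. \<Sum>b\<in>A. \<bar>E a b\<bar> * (F b)\<^sup>2) = ?S"
    by (subst sum.swap) (intro sum.cong refl, simp add: sym)
  have "2 * ?S = (\<Sum>a\<in>A. 2 * (\<Sum>b\<in>A. \<bar>E a b\<bar>) * (F a)\<^sup>2)"
    by (simp add: sum_distrib_left sum_distrib_right mult.assoc)
  also have "\<dots> \<le> (\<Sum>a\<in>A. 4 * E a a * (F a)\<^sup>2)"
    using dom by (intro sum_mono mult_right_mono) auto
  also have "\<dots> \<le> (\<Sum>a\<in>A. \<Sum>b\<in>A. 2 * (F a * F b * E a b) + (\<bar>E a b\<bar> * (F a)\<^sup>2 + \<bar>E a b\<bar> * (F b)\<^sup>2))"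
    by (intro sum_mono row)
  also have "\<dots> = 2 * (\<Sum>a\<in>A. \<Sum>b\<in>A. F a * F b * E a b) + 2 * ?S"
    by (simp add: sum.distrib sum_distrib_left swap)
  finally show ?thesis
    by simp
qed

text \<open>
  Rows of a triangular factor are stored without their trailing zeros; padding them to a common
  length turns all products into sums over one index range.
\<close>

lemma dot_eq_sum:
  assumes "length x \<le> n" "length y \<le> n"
  shows "dot x y = (\<Sum>k<n. (if k < length x then x ! k else 0) * (if k < length y then y ! k else 0))"
proof -
  have "dot x y = (\<Sum>k<min (length x) (length y). x ! k * y ! k)"
    by (simp add: dot_def sum_list_sum_nth atLeast0LessThan)
  also have "\<dots> = (\<Sum>k<n. (if k < length x then x ! k else 0) * (if k < length y then y ! k else 0))"
    using assms by (intro sum.mono_neutral_cong_left) auto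
  finally show ?thesis .
qed

lemma dot_commute: "dot x y = dot y x"
  using dot_eq_sum[of x "max (length x) (length y)" y] dot_eq_sum[of y "max (length x) (length y)" x]
  by (simp add: mult.commute)

lemma gram_certificate_sound:
  assumes cert: "gram_certificate c M rows" and "c > 0"
    and "distinct (map fst rows)" and A: "set (map fst rows) = A"
    and sym: "\<And>a b. M a b = M b a"
  shows "(\<Sum>a\<in>A. \<Sum>b\<in>A. F a * F b * real_of_int (M a b)) \<ge> 0"
proof -
  define g where "g a = the (map_of rows a)" for a
  define E where "E a b = c * M a b - dot (g a) (g b)" for a b
  define n where "n = Max (insert 0 (length ` g ` A))"
  define h where "h a k = real_of_int (if k < length (g a) then g a ! k else 0)" for a k
  have "finite A"
    using A by auto
  have g: "g a = x" if "(a, x) \<in> set rows" for a x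
    using that assms(3) by (simp add: g_def)
  have rows_sum: "(\<Sum>(b, y)\<leftarrow>rows. Q b y) = (\<Sum>b\<in>A. Q b (g b))" for Q :: "'a \<Rightarrow> int list \<Rightarrow> int"
  proof -
    have "(\<Sum>(b, y)\<leftarrow>rows. Q b y) = (\<Sum>b\<leftarrow>map fst rows. Q b (g b))"
      using g by (auto intro!: arg_cong[of _ _ sum_list])
    also have "\<dots> = (\<Sum>b\<in>A. Q b (g b))"
      using assms(3) A by (subst sum_list_distinct_conv_sum_set) auto
    finally show ?thesis .
  qed
  have dom: "(\<Sum>b\<in>A. \<bar>E a b\<bar>) \<le> 2 * E a a" if "a \<in> A" for a
  proof -
    from that A obtain x where ax: "(a, x) \<in> set rows"
      by auto
    show ?thesis
      using cert[unfolded gram_certificate_def rows_dominant_iff, rule_format, OF ax] g[OF ax]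
      unfolding rows_sum E_def by (auto simp: rows_sum)
  qed
  have "0 \<le> (\<Sum>a\<in>A. \<Sum>b\<in>A. F a * F b * real_of_int (E a b))"
  proof (rule diagonally_dominant_nonneg)
    show "real_of_int (E a b) = real_of_int (E b a)" for a b
      by (simp add: E_def sym[of a b] dot_commute[of "g a"])
    show "(\<Sum>b\<in>A. \<bar>real_of_int (E a b)\<bar>) \<le> 2 * real_of_int (E a a)" if "a \<in> A" for a
      using dom[OF that] by (simp flip: of_int_abs of_int_sum)
  qed fact
  moreover have "real_of_int (dot (g a) (g b)) = (\<Sum>k<n. h a k * h b k)" if "a \<in> A" "b \<in> A" for a b
  proof -
    have "length (g a) \<le> n" "length (g b) \<le> n"
      using that \<open>finite A\<close> unfolding n_def by (auto intro!: Max_ge)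
    then show ?thesis
      unfolding h_def by (simp only: dot_eq_sum of_int_sum of_int_mult)
  qed
  then have "(\<Sum>a\<in>A. \<Sum>b\<in>A. F a * F b * real_of_int (dot (g a) (g b)))
      = (\<Sum>a\<in>A. \<Sum>b\<in>A. \<Sum>k<n. (F a * h a k) * (F b * h b k))"
    by (intro sum.cong refl) (simp add: sum_distrib_left mult_ac)
  then have "(\<Sum>a\<in>A. \<Sum>b\<in>A. F a * F b * real_of_int (dot (g a) (g b)))
      = (\<Sum>k<n. (\<Sum>a\<in>A. F a * h a k)\<^sup>2)"
    by (simp only: sum.swap[where A = A and B = "{..<n}"] power2_eq_square sum_product)
  then have "0 \<le> (\<Sum>a\<in>A. \<Sum>b\<in>A. F a * F b * real_of_int (dot (g a) (g b)))"
    by (simp add: sum_nonneg)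
  ultimately have "0 \<le> (\<Sum>a\<in>A. \<Sum>b\<in>A. F a * F b * real_of_int (E a b + dot (g a) (g b)))"
    by (simp add: distrib_left sum.distrib)
  also have "\<dots> = real_of_int c * (\<Sum>a\<in>A. \<Sum>b\<in>A. F a * F b * real_of_int (M a b))"
    by (simp add: E_def sum_distrib_left mult_ac)
  finally show ?thesis
    using \<open>c > 0\<close> by (simp add: zero_le_mult_iff)
qed

section \<open>The two Gram matrices of the class function\<close>

text \<open>
  The rows belong to the words of \<open>words 3 3\<close> and \<open>words 2 3\<close> in this order. They are rounded
  Cholesky factors of \<open>10000 * (M - 0.86)\<close> and \<open>500 * (M - 0.84)\<close> for the respective matrix \<open>M\<close>.
\<close>

definition cholesky_even :: "int list list" where
  "cholesky_even = [
    [2088],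
    [-388, 1114],
    [-268, -201, 894],
    [316, -123, -134, 573],
    [-268, -201, 165, -118, 870],
    [158, -71, -80, 245, -34, 209],
    [-124, 280, -53, -163, -66, 14, 232],
    [-1743, -391, -756, 421, -576, 68, 310, 894],
    [-86, -93, 166, -178, 80, 32, -216, 84, 212],
    [225, -65, -104, 588, 5, -12, -13, -91, -94, 180],
    [316, -123, -101, 229, -88, 402, -24, 111, -80, 129, 280],
    [-124, 280, -53, -58, -52, -107, 181, -13, -40, 7, -136, 119],
    [-72, -88, 138, -174, 92, 9, -213, 96, 283, -4, -188, -49, 2220],
    [-86, -93, 132, -64, 137, -106, -205, 45, 212, -89, -83, 0, 5, 100],
    [101, -28, -43, 260, -1, 119, -6, -50, -54, 111, 106, -19, 19, 20, 130],
    [-77, 144, -47, -182, -64, 5, 448, -58, 88, -233, -16, 129, -29, -55, -58, 745],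
    [225, -65, -93, 259, -54, 369, 21, -6, -131, 197, 337, -97, 5, 62, 18, -21, 89],
    [-77, 144, -47, -165, -61, -15, 333, -23, -26, -175, -119, 392, -28, -112, -31, -71, -51, 720],
    [-67, -68, 177, -215, 119, 33, -334, 203, 850, -57, -135, 223, -86, 242, 0, -114, -26, -131, 497],
    [206, -54, -129, 665, -18, -2, -168, -165, -606, 730, 371, -495, -1484, 187, -130, -139, 313, -69, -257, 275]]"

definition cholesky_odd :: "int list list" where
  "cholesky_odd = [
    [180],
    [-72, 111],
    [-50, -64, 50],
    [130, 12, 6, 63],
    [-42, -58, 44, -10, 21],
    [58, 6, 6, 29, -10, 26],
    [-44, 57, -22, -29, -17, 1, 48],
    [-44, 57, -22, -21, -14, -6, 32, 16],
    [-39, -48, 90, -46, 34, 6, -27, -9, 40],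
    [119, 14, -23, 126, 1, -1, -29, 1, -16, 24]]"

definition even_entry :: "letter list \<Rightarrow> letter list \<Rightarrow> int"
  where "even_entry a b = class_value (rev a @ b)"

definition odd_entry :: "letter list \<Rightarrow> letter list \<Rightarrow> int"
  where "odd_entry a b = class_value (rev a @ LX # b @ [LX])"

lemma even_certificate: "gram_certificate 10000 even_entry (zip (words 3 3) cholesky_even)"
  by code_simp

lemma odd_certificate: "gram_certificate 500 odd_entry (zip (words 2 3) cholesky_odd)"
  by code_simp

lemma even_form_nonneg:
  "(\<Sum>a\<in>bidegree_words 3 3. \<Sum>b\<in>bidegree_words 3 3.
      F a * F b * real_of_int (class_value (rev a @ b))) \<ge> 0"
proof -
  have "map fst (zip (words 3 3) cholesky_even) = words 3 3"
    by (simp add: cholesky_even_def numeral_3_eq_3)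
  moreover have "even_entry a b = even_entry b a" for a b
    unfolding even_entry_def by (subst class_value_rev[symmetric]) simp
  ultimately show ?thesis
    using gram_certificate_sound[OF even_certificate, of "bidegree_words 3 3" F]
    by (simp add: distinct_words set_words flip: even_entry_def)
qed

lemma odd_form_nonneg_X:
  "(\<Sum>a\<in>bidegree_words 2 3. \<Sum>b\<in>bidegree_words 2 3.
      F a * F b * real_of_int (class_value (rev a @ LX # b @ [LX]))) \<ge> 0"
proof -
  have "map fst (zip (words 2 3) cholesky_odd) = words 2 3"
    by (simp add: cholesky_odd_def numeral_3_eq_3 numeral_2_eq_2)
  moreover have "odd_entry a b = odd_entry b a" for a b
    unfolding odd_entry_def
    by (subst class_value_rev[symmetric], subst class_value_rotate1[symmetric]) simp
  ultimately show ?thesis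
    using gram_certificate_sound[OF odd_certificate, of "bidegree_words 2 3" F]
    by (simp add: distinct_words set_words flip: odd_entry_def)
qed

text \<open>
  Interchanging the letters carries this form to the previous one.
\<close>

lemma odd_form_nonneg_Y:
  "(\<Sum>a\<in>bidegree_words 3 2. \<Sum>b\<in>bidegree_words 3 2.
      F a * F b * real_of_int (class_value (rev a @ LY # b @ [LY]))) \<ge> 0"
proof -
  let ?s = "map swap_letter"
  have count: "count_list (?s w) l = count_list w (swap_letter l)" for w l
  proof (induction w)
    case (Cons k w)
    then show ?case
      by (cases k; cases l) auto
  qed simp
  have ss: "?s (?s w) = w" for w
    by (simp add: o_def)
  have img: "bidegree_words 3 2 = ?s ` bidegree_words 2 3"
  proof (intro equalityI subsetI)
    fix w
    assume "w \<in> bidegree_words 3 2"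
    then have "?s w \<in> bidegree_words 2 3"
      by (simp add: bidegree_words_def count)
    then show "w \<in> ?s ` bidegree_words 2 3"
      by (metis image_eqI ss)
  qed (auto simp: bidegree_words_def count)
  have inj: "inj_on ?s A" for A
    by (metis inj_onI ss)
  have "class_value (rev (?s a) @ LY # ?s b @ [LY]) = class_value (rev a @ LX # b @ [LX])" for a b
    by (subst class_value_swap[symmetric]) (simp add: rev_map o_def)
  then show ?thesis
    unfolding img using odd_form_nonneg_X[of "\<lambda>a. F (?s a)"]
    by (simp add: sum.reindex[OF inj])
qed

section \<open>The separating functional\<close>

fun halve :: "letter list \<Rightarrow> letter list" where
  "halve (x # y # w) = x # halve w"
| "halve _ = []"

definition double :: "letter list \<Rightarrow> letter list"
  where "double w = concat (map (\<lambda>l. [l, l]) w)"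

definition even_value :: "letter list \<Rightarrow> real"
  where "even_value w = (if w \<in> range double then real_of_int (class_value (halve w)) else 0)"

text \<open>
  \<open>double\<close> substitutes \<open>X\<^sup>2\<close> and \<open>Y\<^sup>2\<close> for the two letters. A word is a rotation of a word in the
  squares exactly if it is such a word itself or becomes one by moving its first letter to the
  end; the two summands in \<open>weight\<close> cover these two cases, and rotation by one letter
  interchanges them.
\<close>

definition weight :: "letter list \<Rightarrow> real" where
  "weight w = (if w \<in> bidegree_words 12 12 then even_value w + even_value (rotate1 w) else 0)"

lemma double_simps [simp]:
  "double [] = []" "double (l # w) = l # l # double w"
  "double (v @ w) = double v @ double w" "rev (double w) = double (rev w)"
  by (induction w) (simp_all add: double_def rev_concat rev_map o_def)

lemma halve_double [simp]: "halve (double w) = w"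
  by (induction w) simp_all

lemma inj_double: "inj double"
  by (metis halve_double injI)

lemma length_double [simp]: "length (double w) = 2 * length w"
  by (induction w) simp_all

lemma count_list_double [simp]: "count_list (double w) l = 2 * count_list w l"
  by (induction w) simp_all

lemma even_value_double [simp]: "even_value (double w) = real_of_int (class_value w)"
  by (simp add: even_value_def)

text \<open>
  An even cut of a word in the squares does not separate a pair of equal letters.
\<close>

lemma append_eq_double:
  assumes "v @ w = double c" "even (length v)"
  obtains a b where "v = double a" "w = double b"
proof -
  have "\<exists>a b. v = double a \<and> w = double b"
    using assms
  proof (induction v arbitrary: c rule: induct_list012)
    case (3 x y v)
    then obtain l c' where c: "c = l # c'"
      by (cases c) auto
    then have "v @ w = double c'" "even (length v)"
      using 3 by auto
    then obtain a b where "v = double a" "w = double b"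
      using 3 by blast
    then show ?case
      using 3 c by (intro exI[of _ "l # a"] exI[of _ b]) simp
  qed (auto intro: exI[of _ "[]"])
  then show thesis
    using that by blast
qed

lemma rotate1_rotate1_double: "rotate1 (rotate1 (double w)) = double (rotate1 w)"
  by (cases w) simp_all

lemma even_value_rotate2: "even_value (rotate1 (rotate1 w)) = even_value w"
proof (cases "w \<in> range double")
  case True
  then show ?thesis
    by (auto simp: rotate1_rotate1_double)
next
  case False
  have "rotate1 (rotate1 w) \<notin> range double"
  proof
    assume "rotate1 (rotate1 w) \<in> range double"
    then obtain d where "rotate1 (rotate1 w) = double d"
      by blast
    moreover obtain c where "d = rotate1 c"
      using surj_rotate1 by (metis surjD)
    ultimately have "rotate1 (rotate1 w) = rotate1 (rotate1 (double c))"
      by (simp add: rotate1_rotate1_double)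
    then have "w = double c"
      using inj_rotate1 by (metis injD)
    then show False
      using False by blast
  qed
  then show ?thesis
    using False by (simp add: even_value_def)
qed

lemma count_list_rotate1 [simp]: "count_list (rotate1 w) l = count_list w l"
  by (cases w) simp_all

lemma tracial_weight: "tracial weight"
proof -
  have rot1: "weight (rotate1 w) = weight w" for w
    by (simp add: weight_def bidegree_words_def even_value_rotate2)
  have "weight (rotate n w) = weight w" for n w
    by (induction n) (simp_all add: rot1)
  then show ?thesis
    unfolding tracial_def by (metis rotate_append)
qed

lemma Cons_double_snoc_eq_double:
  assumes "x # double w @ [y] = double c"
  shows "set c \<subseteq> {x}"
  using assms
proof (induction w arbitrary: c x)
  case Nil
  then show ?case
    by (cases c) (auto simp: double_def)
next
  case (Cons l w)
  then obtain c' where c: "c = x # c'" "l = x" "l # double w @ [y] = double c'"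
    by (cases c) auto
  then show ?case
    using Cons.IH[of l c'] by auto
qed

text \<open>
  Of the two summands of the weight only the first one contributes here: if the rotation by one
  letter of a word in the squares is again a word in the squares, all its letters are equal.
\<close>

lemma weight_double:
  assumes "w \<in> bidegree_words 6 6"
  shows "weight (double w) = real_of_int (class_value w)"
proof -
  have "rotate1 (double w) \<notin> range double"
  proof
    assume "rotate1 (double w) \<in> range double"
    then obtain c where c: "rotate1 (double w) = double c"
      by blast
    from assms obtain l w' where w: "w = l # w'"
      by (cases w) (auto simp: bidegree_words_def)
    have "set c \<subseteq> {l}"
      using c w by (intro Cons_double_snoc_eq_double[of l w' l]) simp
    moreover have "2 * count_list c z = 12" for z
      using assms by (simp flip: count_list_double c) (cases z; simp add: bidegree_words_def)
    then have "count_list c LX \<noteq> 0" "count_list c LY \<noteq> 0"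
      by (metis mult_0_right zero_neq_numeral)+
    then have "LX \<in> set c" "LY \<in> set c"
      by (meson count_notin)+
    ultimately show False
      by auto
  qed
  then show ?thesis
    using assms by (simp add: weight_def even_value_def) (simp add: bidegree_words_def)
qed

lemma S_poly_squares:
  "S_poly m k (ncX ^ 2) (ncY ^ 2) =
     (\<Sum>w | length w = m \<and> count_list w LY = k. Poly_Mapping.single (Word (double w)) 1)"
proof -
  have "prod_list (map (case_letter (ncX ^ 2) (ncY ^ 2)) w) = Poly_Mapping.single (Word (double w)) 1" for w
  proof (induction w)
    case Nil
    then show ?case
      by (simp flip: zero_word_def)
  next
    case (Cons l w)
    then show ?case
      by (cases l)
        (simp_all add: ncX_def ncY_def power2_eq_square mult_single plus_word_def mult.assoc)
  qed
  then show ?thesis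
    by (simp add: S_poly_def)
qed

lemma S_poly_index: "{w. length w = 12 \<and> count_list w LY = 6} = bidegree_words 6 6"
  by (auto simp: bidegree_words_def length_letters)

lemma functional_S_poly: "functional weight (S_poly 12 6 (ncX ^ 2) (ncY ^ 2)) = - 924"
proof -
  have "functional weight (S_poly 12 6 (ncX ^ 2) (ncY ^ 2)) =
      real_of_int (\<Sum>w\<in>bidegree_words 6 6. class_value w)"
    by (simp add: S_poly_squares S_poly_index functional_sum weight_double)
  then show ?thesis
    by (simp add: sum_class_value)
qed

lemma support_S_poly:
  assumes "w \<in> support (S_poly 12 6 (ncX ^ 2) (ncY ^ 2))"
  shows "count_list w z = 12"
proof -
  have "coeff (S_poly 12 6 (ncX ^ 2) (ncY ^ 2)) w \<noteq> 0"
    using assms by (simp add: in_support_iff)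
  then obtain v where "v \<in> bidegree_words 6 6" "w = double v"
    unfolding coeff_def S_poly_squares S_poly_index lookup_sum
    by (auto simp: lookup_single when_def elim!: sum.not_neutral_contains_not_neutral split: if_splits)
  then show ?thesis
    by (cases z) (auto simp: bidegree_words_def)
qed

text \<open>
  A quadratic form whose matrix is supported on the image of an injection can be summed over
  its domain.
\<close>

lemma double_sum_reindex:
  fixes G :: "'b \<Rightarrow> 'b \<Rightarrow> real"
  assumes "finite U" "inj_on h V" "h ` V \<subseteq> U"
    and "\<And>u v. u \<in> U \<Longrightarrow> v \<in> U \<Longrightarrow> G u v \<noteq> 0 \<Longrightarrow> u \<in> h ` V \<and> v \<in> h ` V"
  shows "(\<Sum>u\<in>U. \<Sum>v\<in>U. G u v) = (\<Sum>a\<in>V. \<Sum>b\<in>V. G (h a) (h b))"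
proof -
  have outside: "G u v = 0" if "u \<in> U" "v \<in> U" "u \<notin> h ` V \<or> v \<notin> h ` V" for u v
    using assms(4) that by blast
  have "(\<Sum>u\<in>U. \<Sum>v\<in>U. G u v) = (\<Sum>u\<in>h ` V. \<Sum>v\<in>U. G u v)"
    using assms(1,3) outside by (intro sum.mono_neutral_right ballI sum.neutral) auto
  also have "\<dots> = (\<Sum>u\<in>h ` V. \<Sum>v\<in>h ` V. G u v)"
    using assms(1,3) outside by (intro sum.cong refl sum.mono_neutral_right ballI) auto
  finally show ?thesis
    using assms(2) by (simp add: sum.reindex)
qed

lemma even_part_nonneg:
  "(\<Sum>u\<in>bidegree_words 6 6. \<Sum>v\<in>bidegree_words 6 6. F u * F v * even_value (rev u @ v)) \<ge> 0"
proof -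
  have "(\<Sum>u\<in>bidegree_words 6 6. \<Sum>v\<in>bidegree_words 6 6. F u * F v * even_value (rev u @ v)) =
    (\<Sum>a\<in>bidegree_words 3 3. \<Sum>b\<in>bidegree_words 3 3.
       F (double a) * F (double b) * even_value (rev (double a) @ double b))"
  proof (rule double_sum_reindex)
    show "inj_on double (bidegree_words 3 3)"
      using inj_double by (rule inj_on_subset) simp
    fix u v
    assume uv: "u \<in> bidegree_words 6 6" "v \<in> bidegree_words 6 6"
      and "F u * F v * even_value (rev u @ v) \<noteq> 0"
    then obtain c where "rev u @ v = double c"
      by (auto simp: even_value_def split: if_splits)
    then obtain a b where "rev u = double a" "v = double b"
      by (rule append_eq_double) (use uv in \<open>simp add: length_bidegree_words\<close>)
    moreover from this have "u = double (rev a)"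
      by (metis double_simps(4) rev_rev_ident)
    ultimately show "u \<in> double ` bidegree_words 3 3 \<and> v \<in> double ` bidegree_words 3 3"
      using uv by (auto simp: bidegree_words_def)
  next
    show "double ` bidegree_words 3 3 \<subseteq> bidegree_words 6 6"
      by (auto simp: bidegree_words_def)
  qed simp
  also have "\<dots> = (\<Sum>a\<in>bidegree_words 3 3. \<Sum>b\<in>bidegree_words 3 3.
       F (double a) * F (double b) * real_of_int (class_value (rev a @ b)))"
    by (simp only: double_simps(4) double_simps(3)[symmetric] even_value_double)
  finally show ?thesis
    using even_form_nonneg[of "\<lambda>a. F (double a)"] by simp
qed

text \<open>
  If the rotation of \<open>rev u @ v\<close> by one letter is a word in the squares, the pairs of equal letters
  straddle the junctions: the first letter of \<open>u\<close> is paired with the first letter of \<open>v\<close>, and the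
  last letter of \<open>u\<close> with the last letter of \<open>v\<close>. That the first and the last letter agree as well is
  due to the even degree of \<open>u\<close> in both letters.
\<close>

lemma odd_part_support:
  assumes uv: "u \<in> bidegree_words 6 6" "v \<in> bidegree_words 6 6"
    and "rotate1 (rev u @ v) \<in> range double"
  obtains l a b where "u = l # double a @ [l]" "v = l # double b @ [l]"
proof -
  have split: "\<exists>x m y. w = x # m @ [y] \<and> length m = 10" if "w \<in> bidegree_words 6 6" for w
  proof -
    have "length w = 12"
      using length_bidegree_words[OF that] by simp
    then obtain x w' where "w = x # w'" "length w' = 11"
      by (cases w) auto
    moreover from this obtain m y where "w' = m @ [y]"
      by (cases w' rule: rev_cases) auto
    ultimately show ?thesis
      by auto
  qed
  obtain x m y where u: "u = x # m @ [y]" "length m = 10"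
    using split[OF uv(1)] by blast
  obtain x' n y' where v: "v = x' # n @ [y']" "length n = 10"
    using split[OF uv(2)] by blast
  from assms(3) obtain c where "rev m @ ([x, x'] @ (n @ [y', y])) = double c"
    by (auto simp: u v)
  then obtain a c' where a: "rev m = double a" and c': "[x, x'] @ (n @ [y', y]) = double c'"
    by (rule append_eq_double) (simp add: u)
  from c' obtain d c'' where x: "[x, x'] = double d" and c'': "n @ [y', y] = double c''"
    by (rule append_eq_double) simp
  from c'' obtain b e where b: "n = double b" and y: "[y', y] = double e"
    by (rule append_eq_double) (simp add: v)
  have "x' = x"
    using x by (cases d) auto
  moreover have "y' = y"
    using y by (cases e) auto
  moreover have m: "m = double (rev a)"
    using a by (metis double_simps(4) rev_rev_ident)
  have "count_list u LX = 6"
    using uv by (simp add: bidegree_words_def)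
  then have "even (count_list u LX)"
    by simp
  then have "y = x"
    unfolding u m by (cases x; cases y) auto
  ultimately show thesis
    using that[of x "rev a" b] u v m b by simp
qed

text \<open>
  By the previous lemma the form splits into a block of words that begin and end with \<open>LX\<close> and a
  block of words that begin and end with \<open>LY\<close>.
\<close>

lemma odd_part_nonneg:
  "(\<Sum>u\<in>bidegree_words 6 6. \<Sum>v\<in>bidegree_words 6 6.
      F u * F v * even_value (rotate1 (rev u @ v))) \<ge> 0"
proof -
  define G where "G u v = F u * F v * even_value (rotate1 (rev u @ v))" for u v
  define U where "U l = {u \<in> bidegree_words 6 6. hd u = l}" for l
  let ?h = "\<lambda>l a. l # double a @ [l]"
  have U: "bidegree_words 6 6 = U LX \<union> U LY" "U LX \<inter> U LY = {}" "finite (U l)" for l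
    by (auto simp: U_def) (metis letter.exhaust)
  have G: "\<exists>l a b. u = ?h l a \<and> v = ?h l b"
    if "u \<in> bidegree_words 6 6" "v \<in> bidegree_words 6 6" "G u v \<noteq> 0" for u v
  proof -
    have "rotate1 (rev u @ v) \<in> range double"
      using that(3) by (auto simp: G_def even_value_def split: if_splits)
    then show ?thesis
      using odd_part_support[OF that(1,2)] by metis
  qed
  have cross: "(\<Sum>u\<in>U l. \<Sum>v\<in>U k. G u v) = 0" if "l \<noteq> k" for l k
  proof (intro sum.neutral ballI)
    fix u v
    assume "u \<in> U l" "v \<in> U k"
    then show "G u v = 0"
      using G[of u v] that by (cases "G u v = 0") (auto simp: U_def)
  qed
  have diag: "(\<Sum>u\<in>U l. \<Sum>v\<in>U l. G u v) =
      (\<Sum>a\<in>V. \<Sum>b\<in>V. F (?h l a) * F (?h l b) * real_of_int (class_value (rev a @ l # b @ [l])))"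
    if V: "\<And>a. a \<in> V \<longleftrightarrow> ?h l a \<in> bidegree_words 6 6" for l V
  proof -
    have "(\<Sum>u\<in>U l. \<Sum>v\<in>U l. G u v) = (\<Sum>a\<in>V. \<Sum>b\<in>V. G (?h l a) (?h l b))"
    proof (rule double_sum_reindex)
      show "inj_on (?h l) V"
        by (auto intro!: inj_onI dest: injD[OF inj_double])
      fix u v
      assume "u \<in> U l" "v \<in> U l" "G u v \<noteq> 0"
      then show "u \<in> ?h l ` V \<and> v \<in> ?h l ` V"
        using G[of u v] V by (force simp: U_def)
    next
      show "?h l ` V \<subseteq> U l"
        using V by (auto simp: U_def)
    qed (rule U(3))
    moreover have "rotate1 (rev (?h l a) @ ?h l b) = double (rev a @ l # b @ [l])" for a b
      by simp
    ultimately show ?thesis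
      unfolding G_def by (simp only: even_value_double)
  qed
  have "(\<Sum>u\<in>bidegree_words 6 6. \<Sum>v\<in>bidegree_words 6 6. G u v) =
      (\<Sum>u\<in>U LX. \<Sum>v\<in>U LX. G u v) + (\<Sum>u\<in>U LY. \<Sum>v\<in>U LY. G u v)"
    unfolding U(1) using U(2,3) cross
    by (simp add: sum.union_disjoint sum.distrib)
  also have "(\<Sum>u\<in>U LX. \<Sum>v\<in>U LX. G u v) = (\<Sum>a\<in>bidegree_words 2 3. \<Sum>b\<in>bidegree_words 2 3.
      F (?h LX a) * F (?h LX b) * real_of_int (class_value (rev a @ LX # b @ [LX])))"
    by (rule diag) (auto simp: bidegree_words_def)
  also have "(\<Sum>u\<in>U LY. \<Sum>v\<in>U LY. G u v) = (\<Sum>a\<in>bidegree_words 3 2. \<Sum>b\<in>bidegree_words 3 2.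
      F (?h LY a) * F (?h LY b) * real_of_int (class_value (rev a @ LY # b @ [LY])))"
    by (rule diag) (auto simp: bidegree_words_def)
  finally show ?thesis
    unfolding G_def using odd_form_nonneg_X[of "\<lambda>a. F (?h LX a)"] odd_form_nonneg_Y[of "\<lambda>a. F (?h LY a)"]
    by linarith
qed

text \<open>
  The degree bound is used here: without it, a word of bidegree (12,12) could be \<open>rev u @ v\<close> with
  \<open>u\<close> and \<open>v\<close> of different bidegrees, and these entries of the matrix are not controlled.
\<close>

lemma functional_weight_square_nonneg:
  assumes deg: "\<And>w z. w \<in> support f \<Longrightarrow> count_list w z \<le> 6"
  shows "functional weight (nc_star f * f) \<ge> 0"
proof -
  let ?U = "bidegree_words 6 6"
  let ?q = "\<lambda>u v. coeff f u * coeff f v * weight (rev u @ v)"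
  have "u \<in> ?U \<and> v \<in> ?U" if "u \<in> support f" "v \<in> support f" "weight (rev u @ v) \<noteq> 0" for u v
  proof -
    have sum12: "count_list u z + count_list v z = 12" for z
      using that(3) by (cases z) (auto simp: weight_def bidegree_words_def split: if_splits)
    then have "count_list u z = 6 \<and> count_list v z = 6" for z
      using sum12[of z] deg[OF that(1), of z] deg[OF that(2), of z] by linarith
    then show ?thesis
      by (simp add: bidegree_words_def)
  qed
  then have *: "?q u v = 0" if "u \<notin> ?U \<or> v \<notin> ?U" for u v
    using that by (metis in_support_iff mult_eq_0_iff)
  let ?A = "support f \<union> ?U"
  have "functional weight (nc_star f * f) = (\<Sum>u\<in>?A. \<Sum>v\<in>?A. ?q u v)"
    unfolding functional_square sum.cartesian_product
    by (intro sum.mono_neutral_left) (auto simp: in_support_iff)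
  also have "\<dots> = (\<Sum>u\<in>?U. \<Sum>v\<in>?U. ?q u v)"
    unfolding sum.cartesian_product
    by (intro sum.mono_neutral_right) (use * in \<open>auto simp del: mult_eq_0_iff\<close>)
  also have "\<dots> = (\<Sum>u\<in>?U. \<Sum>v\<in>?U. coeff f u * coeff f v * even_value (rev u @ v)) +
      (\<Sum>u\<in>?U. \<Sum>v\<in>?U. coeff f u * coeff f v * even_value (rotate1 (rev u @ v)))"
    unfolding sum.distrib[symmetric]
    by (intro sum.cong refl) (auto simp: weight_def bidegree_words_def distrib_left)
  finally show ?thesis
    using even_part_nonneg[of "coeff f"] odd_part_nonneg[of "coeff f"] by linarith
qed

theorem proposition2p5:
  shows "\<not> (\<exists>q. sum_of_squares q \<and> cyclically_equivalent (S_poly 12 6 (ncX ^ 2) (ncY ^ 2)) q)"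
proof
  let ?S = "S_poly 12 6 (ncX ^ 2) (ncY ^ 2)"
  assume "\<exists>q. sum_of_squares q \<and> cyclically_equivalent ?S q"
  then obtain fs where fs: "cyclically_equivalent ?S (\<Sum>f\<leftarrow>fs. nc_star f * f)"
    by (auto simp: sum_of_squares_def)
  have "count_list w z \<le> 6" if "f \<in> set fs" "w \<in> support f" for f w z
    using support_degree_bound[OF fs _ that, of z 6] by (simp add: support_S_poly)
  then have "0 \<le> (\<Sum>f\<leftarrow>fs. functional weight (nc_star f * f))"
    by (intro sum_list_nonneg) (auto intro: functional_weight_square_nonneg)
  also have "\<dots> = functional weight ?S"
    using functional_cyclically_equivalent[OF tracial_weight fs] by (simp add: functional_sum_list)
  finally show False
    by (simp add: functional_S_poly)
qed

end
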